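(* Let $\mathcal{A}\subseteq\omega^\omega$ be a closed mass problem (in the Baire topology) with $\mathcal{A}\not\equiv_M 0$ (i.e. its Medvedev degree is not $\mathbf{0}$). Then there is a join-irreducible Medvedev degree $\mathbf{J}$ with $\mathbf{0}'<_M\mathbf{J}\le_M\deg_M(\mathcal{A})$.
   Context: A mass problem is a subset of Baire space $\omega^\omega$. $\mathcal{A}\le_M\mathcal{B}$ iff there is a partial Turing functional $\Psi$ such that for every $f\in\mathcal{B}$, $\Psi(f)$ is defined and $\Psi(f)\in\mathcal{A}$; Medvedev degrees are the $\equiv_M$-classes, forming a distributive lattice under join $\mathcal{A}+\mathcal{B}=\{f\oplus g: f\in\mathcal{A},g\in\mathcal{B}\}$ and meet $\mathcal{A}\times\mathcal{B}=\{\langle0\rangle^\frown f:f\in\mathcal{A}\}\cup\{\langle1\rangle^\frown g:g\in\mathcal{B}\}$; $\mathbf{0}$ is the degree of mass problems containing a computable function. $\mathbf{0}'$ is the degree of $\{f: f\text{ not computable}\}$. A degree $\mathbf{a}$ is join-irreducible if there are no $\mathbf{b},\mathbf{c}<_M\mathbf{a}$ with $\mathbf{a}=\mathbf{b}+\mathbf{c}$. *)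

theory Defs
  imports "HOL-Analysis.Analysis"
begin

section \<open>Oracle computability\<close>

text \<open>
  Kleene's partial recursive functions relative to an oracle \<open>f\<close>. Arities are not tracked by
  the syntax: a code applied to an argument list of unsuitable length simply has no value, except
  that \<open>Zero\<close> accepts every argument list.
\<close>

datatype ocode =
    Zero
  | Succ
  | Proj nat
  | Oracle
  | Comp ocode "ocode list"
  | PrimRec ocode ocode
  | Mu ocode

text \<open>
  \<open>eval f c xs y\<close>: the computation of \<open>c\<close> with oracle \<open>f\<close> on input \<open>xs\<close> halts with output \<open>y\<close>.
  In \<open>Mu\<close>, all values below the least zero have to be defined.
\<close>

inductive eval :: "(nat \<Rightarrow> nat) \<Rightarrow> ocode \<Rightarrow> nat list \<Rightarrow> nat \<Rightarrow> bool" for f :: "nat \<Rightarrow> nat" where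
  eval_Zero: "eval f Zero xs 0"
| eval_Succ: "eval f Succ [x] (Suc x)"
| eval_Proj: "i < length xs \<Longrightarrow> eval f (Proj i) xs (xs ! i)"
| eval_Oracle: "eval f Oracle [x] (f x)"
| eval_Comp: "list_all2 (\<lambda>d y. eval f d xs y) ds ys \<Longrightarrow> eval f c ys z \<Longrightarrow> eval f (Comp c ds) xs z"
| eval_PrimRec_0: "eval f c xs y \<Longrightarrow> eval f (PrimRec c d) (0 # xs) y"
| eval_PrimRec_Suc:
    "eval f (PrimRec c d) (n # xs) r \<Longrightarrow> eval f d (n # r # xs) y
      \<Longrightarrow> eval f (PrimRec c d) (Suc n # xs) y"
| eval_Mu:
    "eval f c (n # xs) 0 \<Longrightarrow> (\<And>m. m < n \<Longrightarrow> \<exists>k. eval f c (m # xs) (Suc k))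
      \<Longrightarrow> eval f (Mu c) xs n"

fun oracle_free :: "ocode \<Rightarrow> bool" where
  "oracle_free Zero = True"
| "oracle_free Succ = True"
| "oracle_free (Proj i) = True"
| "oracle_free Oracle = False"
| "oracle_free (Comp c ds) = (oracle_free c \<and> (\<forall>d \<in> set ds. oracle_free d))"
| "oracle_free (PrimRec c d) = (oracle_free c \<and> oracle_free d)"
| "oracle_free (Mu c) = oracle_free c"

text \<open>An oracle-free code ignores the oracle, so the oracle supplied below is a dummy.\<close>

definition computable :: "(nat \<Rightarrow> nat) \<Rightarrow> bool" where
  "computable g \<longleftrightarrow> (\<exists>c. oracle_free c \<and> (\<forall>n. eval (\<lambda>_. 0) c [n] (g n)))"

text \<open>
  The partial functional on Baire space induced by a code is defined at \<open>f\<close> iff the computation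
  with oracle \<open>f\<close> halts on every input.
\<close>

definition turing_functional :: "((nat \<Rightarrow> nat) \<rightharpoonup> (nat \<Rightarrow> nat)) \<Rightarrow> bool" where
  "turing_functional \<Psi> \<longleftrightarrow> (\<exists>c. \<forall>f g. \<Psi> f = Some g \<longleftrightarrow> (\<forall>n. eval f c [n] (g n)))"

inductive_cases eval_ZeroE: "eval f Zero xs y"
inductive_cases eval_SuccE: "eval f Succ xs y"
inductive_cases eval_ProjE: "eval f (Proj i) xs y"
inductive_cases eval_OracleE: "eval f Oracle xs y"
inductive_cases eval_CompE: "eval f (Comp c ds) xs y"
inductive_cases eval_PrimRec_0E: "eval f (PrimRec c d) (0 # xs) y"
inductive_cases eval_PrimRec_SucE: "eval f (PrimRec c d) (Suc n # xs) y"
inductive_cases eval_MuE: "eval f (Mu c) xs y"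

lemma eval_deterministic: "eval f c xs y \<Longrightarrow> eval f c xs z \<Longrightarrow> y = z"
proof (induction arbitrary: z rule: eval.induct)
  case (eval_Comp xs ds ys c y)
  from eval_Comp.prems obtain ys' where
    ys': "list_all2 (\<lambda>d y. eval f d xs y) ds ys'" "eval f c ys' z"
    by (rule eval_CompE)
  have "ys = ys'"
  proof (rule nth_equalityI)
    show len: "length ys = length ys'"
      using list_all2_lengthD[OF eval_Comp.IH(1)] list_all2_lengthD[OF ys'(1)] by simp
    show "ys ! i = ys' ! i" if "i < length ys" for i
    proof -
      have "\<forall>z. eval f (ds ! i) xs z \<longrightarrow> ys ! i = z"
        using list_all2_nthD2[OF eval_Comp.IH(1) that] by blast
      moreover have "eval f (ds ! i) xs (ys' ! i)"
        using list_all2_nthD2[OF ys'(1)] that len by simp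
      ultimately show ?thesis by blast
    qed
  qed
  with ys'(2) eval_Comp.IH(2) show ?case by blast
next
  case (eval_PrimRec_0 c xs y d)
  then show ?case by (blast elim: eval_PrimRec_0E)
next
  case (eval_PrimRec_Suc c d n xs r y)
  from eval_PrimRec_Suc.prems obtain r' where
    "eval f (PrimRec c d) (n # xs) r'" "eval f d (n # r' # xs) z"
    by (rule eval_PrimRec_SucE)
  with eval_PrimRec_Suc.IH show ?case by blast
next
  case (eval_Mu c n xs)
  from eval_Mu.prems have z: "eval f c (z # xs) 0 \<and> (\<forall>m < z. \<exists>k. eval f c (m # xs) (Suc k))"
    by (rule eval_MuE) blast
  have "\<not> n < z" using z eval_Mu.IH(1) by blast
  moreover have "\<not> z < n" using z eval_Mu.IH(2) by blast
  ultimately show ?case by simp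
qed (erule eval_ZeroE eval_SuccE eval_ProjE eval_OracleE; simp)+

lemma turing_functional_code:
  "\<exists>\<Psi>. turing_functional \<Psi> \<and> (\<forall>f g. \<Psi> f = Some g \<longleftrightarrow> (\<forall>n. eval f c [n] (g n)))"
proof -
  define \<Psi> where "\<Psi> f = (if \<exists>g. \<forall>n. eval f c [n] (g n)
      then Some (SOME g. \<forall>n. eval f c [n] (g n)) else None)" for f
  have "\<Psi> f = Some g \<longleftrightarrow> (\<forall>n. eval f c [n] (g n))" for f g
  proof (cases "\<exists>h. \<forall>n. eval f c [n] (h n)")
    case True
    define h where "h = (SOME h. \<forall>n. eval f c [n] (h n))"
    have h: "\<forall>n. eval f c [n] (h n)" unfolding h_def using True by (rule someI_ex)
    have "\<Psi> f = Some h" using True by (simp add: \<Psi>_def h_def)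
    moreover have "g = h" if "\<forall>n. eval f c [n] (g n)"
    proof
      fix n
      show "g n = h n" using that h eval_deterministic[of f c "[n]"] by blast
    qed
    ultimately show ?thesis using h by auto
  next
    case False
    then show ?thesis by (auto simp: \<Psi>_def)
  qed
  then show ?thesis unfolding turing_functional_def by blast
qed

fun subst_oracle :: "ocode \<Rightarrow> ocode \<Rightarrow> ocode" where
  "subst_oracle e Zero = Zero"
| "subst_oracle e Succ = Succ"
| "subst_oracle e (Proj i) = Proj i"
| "subst_oracle e Oracle = e"
| "subst_oracle e (Comp c ds) = Comp (subst_oracle e c) (map (subst_oracle e) ds)"
| "subst_oracle e (PrimRec c d) = PrimRec (subst_oracle e c) (subst_oracle e d)"
| "subst_oracle e (Mu c) = Mu (subst_oracle e c)"

lemma eval_subst_oracle: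
  assumes "\<And>n. eval f e [n] (g n)"
  shows "eval g c xs y \<Longrightarrow> eval f (subst_oracle e c) xs y"
proof (induction rule: eval.induct)
  case (eval_Comp xs ds ys c z)
  then show ?case
    by (auto intro!: eval.eval_Comp simp: list_all2_conv_all_nth)
next
  case (eval_PrimRec_Suc c d n xs r y)
  then show ?case using eval.eval_PrimRec_Suc by simp
next
  case (eval_Mu c n xs)
  show ?case unfolding subst_oracle.simps
    by (rule eval.eval_Mu) (use eval_Mu.IH in \<open>blast+\<close>)
qed (simp_all add: eval_Zero eval_Succ eval_Proj eval_PrimRec_0 assms)

lemma oracle_free_subst_oracle: "oracle_free e \<Longrightarrow> oracle_free (subst_oracle e c)"
  by (induction c) auto

lemma eval_oracle_free: "eval f c xs y \<Longrightarrow> oracle_free c \<Longrightarrow> eval g c xs y"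
proof (induction rule: eval.induct)
  case (eval_Comp xs ds ys c z)
  then have "list_all2 (\<lambda>d y. eval g d xs y) ds ys"
    by (auto simp: list_all2_conv_all_nth)
  with eval_Comp show ?case by (auto intro: eval.eval_Comp)
next
  case (eval_PrimRec_Suc c d n xs r y)
  then show ?case using eval.eval_PrimRec_Suc by simp
next
  case (eval_Mu c n xs)
  show ?case
    by (rule eval.eval_Mu) (use eval_Mu.IH eval_Mu.prems in \<open>auto\<close>)
qed (simp_all add: eval_Zero eval_Succ eval_Proj eval_PrimRec_0)

section \<open>Medvedev reducibility\<close>

text \<open>
  Baire space is the type \<open>nat \<Rightarrow> nat\<close>; its library topology is the product of the discrete
  topologies on \<open>nat\<close>, so \<open>closed\<close> refers to the Baire topology.
\<close>

definition medvedev_le :: "(nat \<Rightarrow> nat) set \<Rightarrow> (nat \<Rightarrow> nat) set \<Rightarrow> bool" where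
  "medvedev_le A B \<longleftrightarrow>
    (\<exists>\<Psi>. turing_functional \<Psi> \<and> (\<forall>f \<in> B. \<exists>g. \<Psi> f = Some g \<and> g \<in> A))"

definition medvedev_equiv :: "(nat \<Rightarrow> nat) set \<Rightarrow> (nat \<Rightarrow> nat) set \<Rightarrow> bool" where
  "medvedev_equiv A B \<longleftrightarrow> medvedev_le A B \<and> medvedev_le B A"

lemma medvedev_le_iff_code:
  "medvedev_le A B \<longleftrightarrow> (\<exists>c. \<forall>f \<in> B. \<exists>g \<in> A. \<forall>n. eval f c [n] (g n))"
proof
  assume "medvedev_le A B"
  then obtain \<Psi> c where \<Psi>: "\<forall>f \<in> B. \<exists>g. \<Psi> f = Some g \<and> g \<in> A"
    and c: "\<forall>f g. \<Psi> f = Some g \<longleftrightarrow> (\<forall>n. eval f c [n] (g n))"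
    unfolding medvedev_le_def turing_functional_def by (elim exE conjE)
  have "\<forall>f \<in> B. \<exists>g \<in> A. \<forall>n. eval f c [n] (g n)"
    unfolding Bex_def using \<Psi> c by (simp add: conj_commute)
  then show "\<exists>c. \<forall>f \<in> B. \<exists>g \<in> A. \<forall>n. eval f c [n] (g n)" by (rule exI)
next
  assume "\<exists>c. \<forall>f \<in> B. \<exists>g \<in> A. \<forall>n. eval f c [n] (g n)"
  then obtain c where c: "\<forall>f \<in> B. \<exists>g \<in> A. \<forall>n. eval f c [n] (g n)" by blast
  obtain \<Psi> where \<Psi>: "turing_functional \<Psi>"
    "\<forall>f g. \<Psi> f = Some g \<longleftrightarrow> (\<forall>n. eval f c [n] (g n))"
    using turing_functional_code[of c] by (elim exE conjE)
  have "\<forall>f \<in> B. \<exists>g. \<Psi> f = Some g \<and> g \<in> A"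
    using c \<Psi>(2) unfolding Bex_def by (simp add: conj_commute)
  with \<Psi>(1) show "medvedev_le A B" unfolding medvedev_le_def by (intro exI conjI)
qed

lemma medvedev_le_subset: "B \<subseteq> A \<Longrightarrow> medvedev_le A B"
  unfolding medvedev_le_iff_code
  by (intro exI[of _ Oracle] ballI, rule bexI, rule allI, rule eval_Oracle) auto

lemma medvedev_leI:
  assumes "\<And>f. f \<in> B \<Longrightarrow> F f \<in> A" "\<And>f n. f \<in> B \<Longrightarrow> eval f c [n] (F f n)"
  shows "medvedev_le A B"
  unfolding medvedev_le_iff_code
proof (intro exI ballI)
  fix f assume "f \<in> B"
  then show "\<exists>g \<in> A. \<forall>n. eval f c [n] (g n)" using assms by (intro bexI[of _ "F f"]) auto
qed

lemma medvedev_leD: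
  assumes "medvedev_le A B"
  shows "\<exists>c F. \<forall>f \<in> B. F f \<in> A \<and> (\<forall>n. eval f c [n] (F f n))"
proof -
  obtain c where "\<forall>f \<in> B. \<exists>g \<in> A. \<forall>n. eval f c [n] (g n)"
    using assms unfolding medvedev_le_iff_code by (elim exE)
  then have "\<forall>f \<in> B. \<exists>g. g \<in> A \<and> (\<forall>n. eval f c [n] (g n))" by auto
  then have "\<exists>F. \<forall>f \<in> B. F f \<in> A \<and> (\<forall>n. eval f c [n] (F f n))" by (rule bchoice)
  then show ?thesis by (rule exI)
qed

lemma medvedev_le_trans:
  assumes "medvedev_le A B" "medvedev_le B C"
  shows "medvedev_le A C"
proof -
  obtain c F where F: "\<forall>f \<in> B. F f \<in> A \<and> (\<forall>n. eval f c [n] (F f n))"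
    using medvedev_leD[OF assms(1)] by (elim exE)
  obtain d G where G: "\<forall>f \<in> C. G f \<in> B \<and> (\<forall>n. eval f d [n] (G f n))"
    using medvedev_leD[OF assms(2)] by (elim exE)
  show ?thesis
  proof (rule medvedev_leI)
    fix f n assume f: "f \<in> C"
    show "F (G f) \<in> A" using F G f by simp
    have "eval (G f) c [n] (F (G f) n)" "\<And>n. eval f d [n] (G f n)" using F G f by simp_all
    then show "eval f (subst_oracle d c) [n] (F (G f) n)" by (intro eval_subst_oracle)
  qed
qed

definition turing_join :: "(nat \<Rightarrow> nat) \<Rightarrow> (nat \<Rightarrow> nat) \<Rightarrow> nat \<Rightarrow> nat" (infixl "\<oplus>" 65) where
  "(f \<oplus> g) n = (if even n then f (n div 2) else g (n div 2))"

definition mass_join :: "(nat \<Rightarrow> nat) set \<Rightarrow> (nat \<Rightarrow> nat) set \<Rightarrow> (nat \<Rightarrow> nat) set" where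
  "mass_join A B = {f \<oplus> g | f g. f \<in> A \<and> g \<in> B}"

text \<open>Some auxiliary codes, used to show that \<open>mass_join\<close> is a least upper bound.\<close>

definition code_add :: ocode where
  "code_add = PrimRec (Proj 0) (Comp Succ [Proj 1])"

definition code_double :: ocode where
  "code_double = Comp code_add [Proj 0, Proj 0]"

definition code_not :: ocode where
  "code_not = Comp (PrimRec (Comp Succ [Zero]) Zero) [Proj 0]"

definition code_parity :: ocode where
  "code_parity = PrimRec Zero (Comp code_not [Proj 1])"

definition code_half :: ocode where
  "code_half = PrimRec Zero (Comp code_add [Comp code_parity [Proj 0], Proj 1])"

text \<open>Runs \<open>c\<close> only if the value of \<open>b\<close> is positive, and returns 0 otherwise.\<close>

definition code_when :: "ocode \<Rightarrow> ocode \<Rightarrow> ocode" where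
  "code_when b c = Comp (PrimRec Zero (Comp c [Proj 2])) [b, Proj 0]"

definition code_if :: "ocode \<Rightarrow> ocode \<Rightarrow> ocode \<Rightarrow> ocode" where
  "code_if b c d = Comp code_add [code_when b c, code_when (Comp code_not [b]) d]"

lemma eval_Proj': "i < length xs \<Longrightarrow> y = xs ! i \<Longrightarrow> eval f (Proj i) xs y"
  by (simp add: eval_Proj)

lemma eval_Comp1: "eval f d xs y \<Longrightarrow> eval f c [y] z \<Longrightarrow> eval f (Comp c [d]) xs z"
  by (rule eval_Comp[where ys = "[y]"]) auto

lemma eval_Comp2:
  "eval f d xs y \<Longrightarrow> eval f d' xs y' \<Longrightarrow> eval f c [y, y'] z \<Longrightarrow> eval f (Comp c [d, d']) xs z"
  by (rule eval_Comp[where ys = "[y, y']"]) auto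

lemma eval_code_add: "eval f code_add [m, n] (m + n)"
  unfolding code_add_def
proof (induction m)
  case 0
  show ?case by (auto intro!: eval_PrimRec_0 eval_Proj')
next
  case (Suc m)
  show ?case
  proof (rule eval_PrimRec_Suc[OF Suc], rule eval_Comp1)
    show "eval f (Proj 1) [m, m + n, n] (m + n)" by (rule eval_Proj') simp_all
    show "eval f Succ [m + n] (Suc m + n)" using eval_Succ[of f "m + n"] by simp
  qed
qed

lemma eval_code_double: "eval f code_double [n] (2 * n)"
  unfolding code_double_def mult_2
  by (rule eval_Comp2[where y = n and y' = n]) (auto intro: eval_Proj' eval_code_add)

lemma eval_code_not_0: "eval f code_not [0] (Suc 0)"
  unfolding code_not_def
  by (rule eval_Comp1[where y = 0], rule eval_Proj', simp, simp, rule eval_PrimRec_0,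
      rule eval_Comp1[OF eval_Zero], rule eval_Succ)

lemma eval_code_not_1: "eval f code_not [Suc 0] 0"
  unfolding code_not_def
  by (rule eval_Comp1[where y = "Suc 0"], rule eval_Proj', simp, simp, rule eval_PrimRec_Suc,
      rule eval_PrimRec_0, rule eval_Comp1[OF eval_Zero], rule eval_Succ, rule eval_Zero)

lemma eval_code_parity: "eval f code_parity [n] (n mod 2)"
proof (induction n)
  case 0
  show ?case unfolding code_parity_def by (auto intro!: eval_PrimRec_0 eval_Zero)
next
  case (Suc n)
  have *: "eval f code_not [n mod 2] (Suc n mod 2)"
  proof (cases "even n")
    case True
    then have "n mod 2 = 0" "Suc n mod 2 = Suc 0" by presburger+
    then show ?thesis using eval_code_not_0[of f] by simp
  next
    case False
    then have "n mod 2 = Suc 0" "Suc n mod 2 = 0" by presburger+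
    then show ?thesis using eval_code_not_1[of f] by simp
  qed
  have "eval f (Comp code_not [Proj 1]) [n, n mod 2] (Suc n mod 2)"
    by (rule eval_Comp1[OF _ *], rule eval_Proj') simp_all
  with Suc show ?case unfolding code_parity_def by (rule eval_PrimRec_Suc)
qed

lemma eval_code_half: "eval f code_half [n] (n div 2)"
proof (induction n)
  case 0
  show ?case unfolding code_half_def by (auto intro!: eval_PrimRec_0 eval_Zero)
next
  case (Suc n)
  have eq: "n mod 2 + n div 2 = Suc n div 2" by presburger
  have "eval f (Comp code_add [Comp code_parity [Proj 0], Proj 1]) [n, n div 2] (Suc n div 2)"
  proof (rule eval_Comp2)
    show "eval f (Comp code_parity [Proj 0]) [n, n div 2] (n mod 2)"
      by (rule eval_Comp1[OF _ eval_code_parity], rule eval_Proj') simp_all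
    show "eval f (Proj 1) [n, n div 2] (n div 2)" by (rule eval_Proj') simp_all
    show "eval f code_add [n mod 2, n div 2] (Suc n div 2)" unfolding eq[symmetric]
      by (rule eval_code_add)
  qed
  with Suc show ?case unfolding code_half_def by (rule eval_PrimRec_Suc)
qed

lemma eval_code_when_0: "eval f b [n] 0 \<Longrightarrow> eval f (code_when b c) [n] 0"
  unfolding code_when_def
  by (rule eval_Comp2[where y = 0 and y' = n])
     (auto intro!: eval_Proj' eval_PrimRec_0 eval_Zero)

lemma eval_code_when_1:
  assumes "eval f b [n] (Suc 0)" "eval f c [n] y"
  shows "eval f (code_when b c) [n] y"
  unfolding code_when_def
proof (rule eval_Comp2[OF assms(1)])
  show "eval f (Proj 0) [n] n" by (rule eval_Proj') auto
  have "eval f (Comp c [Proj 2]) [0, 0, n] y"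
    by (rule eval_Comp1[OF _ assms(2)], rule eval_Proj') auto
  then show "eval f (PrimRec Zero (Comp c [Proj 2])) [Suc 0, n] y"
    by (rule eval_PrimRec_Suc[OF eval_PrimRec_0[OF eval_Zero]])
qed

lemma eval_code_if_1:
  assumes "eval f b [n] (Suc 0)" "eval f c [n] y"
  shows "eval f (code_if b c d) [n] y"
  unfolding code_if_def
proof (rule eval_Comp2)
  show "eval f (code_when b c) [n] y" using assms by (rule eval_code_when_1)
  show "eval f (code_when (Comp code_not [b]) d) [n] 0"
    by (rule eval_code_when_0, rule eval_Comp1[OF assms(1)], rule eval_code_not_1)
  show "eval f code_add [y, 0] y" using eval_code_add[of f y 0] by simp
qed

lemma eval_code_if_0:
  assumes "eval f b [n] 0" "eval f d [n] y"
  shows "eval f (code_if b c d) [n] y"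
  unfolding code_if_def
proof (rule eval_Comp2)
  show "eval f (code_when b c) [n] 0" using assms(1) by (rule eval_code_when_0)
  show "eval f (code_when (Comp code_not [b]) d) [n] y"
    by (rule eval_code_when_1[OF _ assms(2)], rule eval_Comp1[OF assms(1)], rule eval_code_not_0)
  show "eval f code_add [0, y] y" using eval_code_add[of f 0 y] by simp
qed

lemma turing_join_even [simp]: "(f \<oplus> g) (2 * n) = f n"
  and turing_join_odd [simp]: "(f \<oplus> g) (Suc (2 * n)) = g n"
  by (auto simp: turing_join_def)

lemma medvedev_le_mass_join1: "medvedev_le A (mass_join A B)"
proof (rule medvedev_leI)
  fix h n assume "h \<in> mass_join A B"
  then show "(\<lambda>n. h (2 * n)) \<in> A" by (auto simp: mass_join_def)
  show "eval h (Comp Oracle [code_double]) [n] (h (2 * n))"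
    by (rule eval_Comp1[OF eval_code_double eval_Oracle])
qed

lemma medvedev_le_mass_join2: "medvedev_le B (mass_join A B)"
proof (rule medvedev_leI)
  fix h n assume "h \<in> mass_join A B"
  then show "(\<lambda>n. h (Suc (2 * n))) \<in> B" by (auto simp: mass_join_def)
  show "eval h (Comp Oracle [Comp Succ [code_double]]) [n] (h (Suc (2 * n)))"
    by (rule eval_Comp1[OF eval_Comp1[OF eval_code_double eval_Succ] eval_Oracle])
qed

lemma medvedev_le_mass_join_least:
  assumes "medvedev_le A C" "medvedev_le B C"
  shows "medvedev_le (mass_join A B) C"
proof -
  obtain c F where F: "\<forall>f \<in> C. F f \<in> A \<and> (\<forall>n. eval f c [n] (F f n))"
    using medvedev_leD[OF assms(1)] by (elim exE)
  obtain d G where G: "\<forall>f \<in> C. G f \<in> B \<and> (\<forall>n. eval f d [n] (G f n))"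
    using medvedev_leD[OF assms(2)] by (elim exE)
  show ?thesis
  proof (rule medvedev_leI)
    fix f n assume f: "f \<in> C"
    have "F f \<in> A \<and> G f \<in> B" using F G f by simp
    then show "F f \<oplus> G f \<in> mass_join A B"
      unfolding mass_join_def
      by (intro CollectI exI[of _ "F f"] exI[of _ "G f"] conjI refl) simp_all
    have c: "eval f (Comp c [code_half]) [n] (F f (n div 2))"
      by (rule eval_Comp1[OF eval_code_half]) (use F f in simp)
    have d: "eval f (Comp d [code_half]) [n] (G f (n div 2))"
      by (rule eval_Comp1[OF eval_code_half]) (use G f in simp)
    show "eval f (code_if code_parity (Comp d [code_half]) (Comp c [code_half])) [n]
        ((F f \<oplus> G f) n)"
    proof (cases "even n")
      case True
      then have "eval f code_parity [n] 0"
        using eval_code_parity[of f n] by (simp only: even_iff_mod_2_eq_zero)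
      from eval_code_if_0[OF this c] True show ?thesis by (simp add: turing_join_def)
    next
      case False
      then have "eval f code_parity [n] (Suc 0)"
        using eval_code_parity[of f n] by (simp only: odd_iff_mod_2_eq_one One_nat_def)
      from eval_code_if_1[OF this d] False show ?thesis by (simp add: turing_join_def)
    qed
  qed
qed

section \<open>Medvedev degrees\<close>

quotient_type medvedev_degree = "(nat \<Rightarrow> nat) set" / medvedev_equiv
  morphisms rep_medvedev_degree medvedev_deg
  by (rule equivpI)
     (auto simp: reflp_def symp_def transp_def medvedev_equiv_def
       intro: medvedev_le_subset medvedev_le_trans)

instantiation medvedev_degree :: semilattice_sup
begin

lift_definition less_eq_medvedev_degree :: "medvedev_degree \<Rightarrow> medvedev_degree \<Rightarrow> bool"
  is medvedev_le
  unfolding medvedev_equiv_def by (blast intro: medvedev_le_trans)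

definition less_medvedev_degree :: "medvedev_degree \<Rightarrow> medvedev_degree \<Rightarrow> bool" where
  "less_medvedev_degree a b \<longleftrightarrow> a \<le> b \<and> \<not> b \<le> a"

lift_definition sup_medvedev_degree :: "medvedev_degree \<Rightarrow> medvedev_degree \<Rightarrow> medvedev_degree"
  is mass_join
  unfolding medvedev_equiv_def
  by (meson medvedev_le_mass_join1 medvedev_le_mass_join2 medvedev_le_mass_join_least
      medvedev_le_trans)

instance
proof
  fix a b c :: medvedev_degree
  show "a < b \<longleftrightarrow> a \<le> b \<and> \<not> b \<le> a" by (rule less_medvedev_degree_def)
  show "a \<le> a" by transfer (simp add: medvedev_le_subset)
  show "a \<le> b \<Longrightarrow> b \<le> c \<Longrightarrow> a \<le> c" by transfer (rule medvedev_le_trans)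
  show "a \<le> b \<Longrightarrow> b \<le> a \<Longrightarrow> a = b" by transfer (simp add: medvedev_equiv_def)
  show "a \<le> sup a b" by transfer (rule medvedev_le_mass_join1)
  show "b \<le> sup a b" by transfer (rule medvedev_le_mass_join2)
  show "a \<le> c \<Longrightarrow> b \<le> c \<Longrightarrow> sup a b \<le> c" by transfer (rule medvedev_le_mass_join_least)
qed

end

definition zero_degree :: medvedev_degree where
  "zero_degree = medvedev_deg {f. computable f}"

definition zero_prime_degree :: medvedev_degree where
  "zero_prime_degree = medvedev_deg {f. \<not> computable f}"

lemma medvedev_deg_eq_zero_iff: "medvedev_deg A = zero_degree \<longleftrightarrow> (\<exists>f \<in> A. computable f)"
proof -
  have zero: "computable (\<lambda>_. 0)"
    unfolding computable_def by (intro exI[of _ Zero] conjI allI eval_Zero) simp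
  have le: "medvedev_le B C" if f: "f \<in> B" "computable f" for f B C
  proof -
    obtain c where "oracle_free c" "\<forall>n. eval (\<lambda>_. 0) c [n] (f n)"
      using f(2) unfolding computable_def by (elim exE conjE)
    then have c: "eval g c [n] (f n)" for g n
      by - (rule eval_oracle_free[of "\<lambda>_. 0"], simp_all)
    show ?thesis by (rule medvedev_leI[where F = "\<lambda>_. f" and c = c]) (rule f(1), rule c)
  qed
  have ex: "\<exists>f \<in> A. computable f" if A: "medvedev_le A {f. computable f}"
  proof -
    obtain c F where F:
      "\<forall>f \<in> {f. computable f}. F f \<in> A \<and> (\<forall>n. eval f c [n] (F f n))"
      using medvedev_leD[OF A] by (elim exE)
    have "eval (\<lambda>_. 0) (subst_oracle Zero c) [n] (F (\<lambda>_. 0) n)" for n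
      by (rule eval_subst_oracle[OF eval_Zero]) (use F zero in simp)
    then have "computable (F (\<lambda>_. 0))"
      unfolding computable_def
      by (intro exI[of _ "subst_oracle Zero c"] conjI allI oracle_free_subst_oracle) simp_all
    moreover have "F (\<lambda>_. 0) \<in> A" using F zero by simp
    ultimately show ?thesis by (rule bexI)
  qed
  have "medvedev_deg A = zero_degree \<longleftrightarrow> medvedev_equiv A {f. computable f}"
    unfolding zero_degree_def by (rule medvedev_degree.abs_eq_iff)
  also have "\<dots> \<longleftrightarrow> (\<exists>f \<in> A. computable f)"
  proof
    assume "medvedev_equiv A {f. computable f}"
    then show "\<exists>f \<in> A. computable f" using ex by (simp add: medvedev_equiv_def)
  next
    assume "\<exists>f \<in> A. computable f"
    then obtain f where "f \<in> A" "computable f" by (elim bexE)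
    then show "medvedev_equiv A {f. computable f}"
      unfolding medvedev_equiv_def using le[of f A] le[of f "{f. computable f}"] by simp
  qed
  finally show ?thesis .
qed

definition join_irreducible :: "'a::semilattice_sup \<Rightarrow> bool" where
  "join_irreducible a \<longleftrightarrow> \<not> (\<exists>b c. b < a \<and> c < a \<and> a = sup b c)"

end

theory Submission
  imports Defs
begin

text \<open>
  The degree \<open>J\<close> is that of the complement of the Turing ideal of all functions computable from
  a suitable noncomputable \<open>h\<close>. Such a degree is join-irreducible: a mass problem strictly below
  \<open>J\<close> must meet the ideal, and so does the join of two problems that meet it.

  It remains to find a noncomputable \<open>h\<close> that computes no element of \<open>A\<close>, which is done by a
  finite extension argument. If no extension of a finite binary string prevents \<open>\<Phi>\<^sub>c\<close> from mapping
  into \<open>A\<close>, then every extension can be extended further to make \<open>\<Phi>\<^sub>c\<close> converge at any given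
  argument; searching for such extensions one after the other yields a computable function all of
  whose initial segments are those of elements of \<open>A\<close>, hence a computable element of \<open>A\<close>.
\<close>

section \<open>Total recursive functions of fixed arity\<close>

text \<open>Since codes carry no arity, values are pinned down only on lists of length
  \<open>m\<close>; recursiveness can then be shown by closure rules instead of explicit
  codes.\<close>

definition total_rec :: "nat \<Rightarrow> (nat list \<Rightarrow> nat) \<Rightarrow> bool" where
  "total_rec m F \<longleftrightarrow> (\<exists>d. oracle_free d \<and> (\<forall>f xs. length xs = m \<longrightarrow> eval f d xs (F xs)))"

lemma total_recI:
  "oracle_free d \<Longrightarrow> (\<And>f xs. length xs = m \<Longrightarrow> eval f d xs (F xs)) \<Longrightarrow> total_rec m F"
  unfolding total_rec_def by blast

lemma total_rec_cong:
  assumes "total_rec m G" "\<And>xs. length xs = m \<Longrightarrow> F xs = G xs"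
  shows "total_rec m F"
  using assms unfolding total_rec_def by auto

lemma total_rec_zero: "total_rec m (\<lambda>_. 0)"
  by (rule total_recI[where d = Zero]) (auto intro: eval_Zero)

lemma total_rec_nth: "i < m \<Longrightarrow> total_rec m (\<lambda>xs. xs ! i)"
  by (rule total_recI[where d = "Proj i"]) (auto intro: eval_Proj)

lemma total_rec_comp:
  assumes F: "total_rec (length Gs) F" and Gs: "\<And>G. G \<in> set Gs \<Longrightarrow> total_rec m G"
  shows "total_rec m (\<lambda>xs. F (map (\<lambda>G. G xs) Gs))"
proof -
  obtain c where c: "oracle_free c" "\<And>f xs. length xs = length Gs \<Longrightarrow> eval f c xs (F xs)"
    using F unfolding total_rec_def by auto
  have "\<forall>G \<in> set Gs. \<exists>d. oracle_free d \<and> (\<forall>f xs. length xs = m \<longrightarrow> eval f d xs (G xs))"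
    using Gs unfolding total_rec_def by auto
  then obtain D where D: "\<forall>G \<in> set Gs. oracle_free (D G) \<and>
      (\<forall>f xs. length xs = m \<longrightarrow> eval f (D G) xs (G xs))"
    by (auto dest!: bchoice)
  show ?thesis
  proof (rule total_recI)
    show "oracle_free (Comp c (map D Gs))" using c D by auto
    fix f and xs :: "nat list" assume "length xs = m"
    then show "eval f (Comp c (map D Gs)) xs (F (map (\<lambda>G. G xs) Gs))"
      using c D by (intro eval_Comp[where ys = "map (\<lambda>G. G xs) Gs"])
        (auto simp: list_all2_conv_all_nth)
  qed
qed

lemma total_rec_comp1:
  assumes "total_rec 1 (\<lambda>ys. F (ys ! 0))" "total_rec m G"
  shows "total_rec m (\<lambda>xs. F (G xs))"
  using total_rec_comp[of "[G]" "\<lambda>ys. F (ys ! 0)" m] assms by auto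

lemma total_rec_comp2:
  assumes "total_rec 2 (\<lambda>ys. F (ys ! 0) (ys ! 1))" "total_rec m G" "total_rec m H"
  shows "total_rec m (\<lambda>xs. F (G xs) (H xs))"
  using total_rec_comp[of "[G, H]" "\<lambda>ys. F (ys ! 0) (ys ! 1)" m] assms
  by (auto simp: numeral_2_eq_2)

lemma total_rec_Suc:
  assumes "total_rec m F"
  shows "total_rec m (\<lambda>xs. Suc (F xs))"
proof (rule total_rec_comp1[OF _ assms])
  have "eval f Succ xs (Suc (xs ! 0))" if "length xs = 1" for f xs
    using that eval_Succ by (auto simp: length_Suc_conv)
  then show "total_rec 1 (\<lambda>ys. Suc (ys ! 0))"
    by (intro total_recI[where d = Succ]) auto
qed

lemma total_rec_const: "total_rec m (\<lambda>_. k)"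
  by (induction k) (simp_all add: total_rec_zero total_rec_Suc)

lemma total_rec_rec_nat:
  assumes B: "total_rec m B" and S: "total_rec (Suc (Suc m)) S" and N: "total_rec m N"
  shows "total_rec m (\<lambda>xs. rec_nat (B xs) (\<lambda>n r. S (n # r # xs)) (N xs))"
proof -
  define R where "R xs = rec_nat (B (tl xs)) (\<lambda>n r. S (n # r # tl xs)) (hd xs)" for xs
  obtain b where b: "oracle_free b" "\<And>f xs. length xs = m \<Longrightarrow> eval f b xs (B xs)"
    using B unfolding total_rec_def by auto
  obtain s where s: "oracle_free s" "\<And>f xs. length xs = Suc (Suc m) \<Longrightarrow> eval f s xs (S xs)"
    using S unfolding total_rec_def by auto
  have "eval f (PrimRec b s) (n # xs) (R (n # xs))" if "length xs = m" for f n xs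
  proof (induction n)
    case 0
    show ?case using b that by (simp add: R_def eval_PrimRec_0)
  next
    case (Suc n)
    show ?case by (rule eval_PrimRec_Suc[OF Suc]) (use s that in \<open>simp add: R_def\<close>)
  qed
  then have "total_rec (Suc m) R"
    by (intro total_recI[where d = "PrimRec b s"]) (auto simp: b s length_Suc_conv)
  then have "total_rec m (\<lambda>xs. R (map (\<lambda>G. G xs) (N # map (\<lambda>i xs. xs ! i) [0..<m])))"
    by (intro total_rec_comp) (auto simp: N total_rec_nth)
  moreover have "map (\<lambda>i. xs ! i) [0..<m] = xs" if "length xs = m" for xs :: "nat list"
    using map_nth[of xs] that by simp
  ultimately show ?thesis
    by (elim total_rec_cong) (simp add: R_def comp_def)
qed

lemma total_rec_LEAST:
  assumes F: "total_rec (Suc m) F" and ex: "\<And>xs. length xs = m \<Longrightarrow> \<exists>n. F (n # xs) = 0"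
  shows "total_rec m (\<lambda>xs. LEAST n. F (n # xs) = 0)"
proof -
  obtain c where c: "oracle_free c" "\<And>f xs. length xs = Suc m \<Longrightarrow> eval f c xs (F xs)"
    using F unfolding total_rec_def by auto
  show ?thesis
  proof (rule total_recI[where d = "Mu c"])
    fix f and xs :: "nat list" assume xs: "length xs = m"
    let ?n = "LEAST n. F (n # xs) = 0"
    have "F (?n # xs) = 0" using ex[OF xs] by (rule LeastI_ex)
    moreover have "\<exists>k. F (k' # xs) = Suc k" if "k' < ?n" for k'
      using not_less_Least[OF that] not0_implies_Suc by blast
    ultimately show "eval f (Mu c) xs ?n"
      using c(2) xs by (intro eval_Mu) (metis length_Cons)+
  qed (use c in simp)
qed

text \<open>Case distinction is a primitive recursion on \<open>B xs\<close> whose step ignores both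
  the counter and the previous value.\<close>

lemma total_rec_if_zero:
  assumes "total_rec m B" "total_rec m F" "total_rec m G"
  shows "total_rec m (\<lambda>xs. if B xs = 0 then F xs else G xs)"
proof -
  have "total_rec 3 (\<lambda>ys. rec_nat (ys ! 1) (\<lambda>_ _. ys ! 2) (ys ! 0))"
    \<comment> \<open>Index 4 is parameter 2, shifted by the counter and the previous value in
      front.\<close>
    using total_rec_rec_nat[of 3 "\<lambda>ys. ys ! 1" "\<lambda>ys. ys ! 4" "\<lambda>ys. ys ! 0"]
    by (simp add: total_rec_nth)
  then have "total_rec m (\<lambda>xs. rec_nat (F xs) (\<lambda>_ _. G xs) (B xs))"
    using total_rec_comp[of "[B, F, G]" "\<lambda>ys. rec_nat (ys ! 1) (\<lambda>_ _. ys ! 2) (ys ! 0)" m] assms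
    by (auto simp: numeral_3_eq_3 numeral_2_eq_2)
  then show ?thesis
    by (rule total_rec_cong) (auto simp: gr0_conv_Suc)
qed

lemma total_rec_add:
  assumes "total_rec m F" "total_rec m G"
  shows "total_rec m (\<lambda>xs. F xs + G xs)"
proof (rule total_rec_comp2[OF _ assms])
  have "eval f code_add xs (xs ! 0 + xs ! 1)" if "length xs = 2" for f xs
    using that eval_code_add by (auto simp: length_Suc_conv numeral_2_eq_2)
  then show "total_rec 2 (\<lambda>ys. ys ! 0 + ys ! 1)"
    by (intro total_recI[where d = code_add]) (auto simp: code_add_def)
qed

lemma total_rec_half:
  assumes "total_rec m F"
  shows "total_rec m (\<lambda>xs. F xs div 2)"
proof (rule total_rec_comp1[OF _ assms])
  have "eval f code_half xs (xs ! 0 div 2)" if "length xs = 1" for f xs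
    using that eval_code_half by (auto simp: length_Suc_conv)
  then show "total_rec 1 (\<lambda>ys. ys ! 0 div 2)"
    by (intro total_recI[where d = code_half])
      (auto simp: code_half_def code_add_def code_parity_def code_not_def)
qed

lemma total_rec_parity:
  assumes "total_rec m F"
  shows "total_rec m (\<lambda>xs. F xs mod 2)"
proof (rule total_rec_comp1[OF _ assms])
  have "eval f code_parity xs (xs ! 0 mod 2)" if "length xs = 1" for f xs
    using that eval_code_parity by (auto simp: length_Suc_conv)
  then show "total_rec 1 (\<lambda>ys. ys ! 0 mod 2)"
    by (intro total_recI[where d = code_parity])
      (auto simp: code_parity_def code_not_def)
qed

lemma total_rec_pred:
  assumes "total_rec m F"
  shows "total_rec m (\<lambda>xs. F xs - 1)"
proof (rule total_rec_comp1[OF _ assms])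
  have "total_rec 1 (\<lambda>xs. rec_nat 0 (\<lambda>n r. (n # r # xs) ! 0) (xs ! 0))"
    by (intro total_rec_rec_nat total_rec_const total_rec_nth) simp_all
  moreover have "rec_nat 0 (\<lambda>n r. n) k = k - 1" for k :: nat
    by (cases k) simp_all
  ultimately show "total_rec 1 (\<lambda>ys. ys ! 0 - 1)"
    by simp
qed

lemma total_rec_diff:
  assumes "total_rec m F" "total_rec m G"
  shows "total_rec m (\<lambda>xs. F xs - G xs)"
proof (rule total_rec_comp2[OF _ assms])
  have "total_rec 2 (\<lambda>xs. rec_nat (xs ! 0) (\<lambda>n r. (n # r # xs) ! 1 - 1) (xs ! 1))"
    by (intro total_rec_rec_nat total_rec_pred total_rec_nth) simp_all
  moreover have "rec_nat a (\<lambda>n r. r - 1) k = a - k" for a k :: nat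
    by (induction k) simp_all
  ultimately show "total_rec 2 (\<lambda>ys. ys ! 0 - ys ! 1)"
    by simp
qed

text \<open>Bit \<open>k\<close> of \<open>a\<close> is the parity left after halving
  \<open>a\<close> \<open>k\<close> times.\<close>

lemma total_rec_bit:
  assumes "total_rec m F" "total_rec m G"
  shows "total_rec m (\<lambda>xs. of_bool (bit (F xs) (G xs)))"
proof (rule total_rec_comp2[OF _ assms])
  have "total_rec 2 (\<lambda>xs. rec_nat (xs ! 0) (\<lambda>n r. (n # r # xs) ! 1 div 2) (xs ! 1) mod 2)"
    by (intro total_rec_rec_nat total_rec_parity total_rec_half total_rec_nth) simp_all
  moreover have "rec_nat a (\<lambda>n r. r div 2) k = a div 2 ^ k" for a k :: nat
    by (induction k) (simp_all add: mult.commute flip: div_mult2_eq)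
  moreover have "of_bool (bit a k) = (a div 2 ^ k) mod 2" for a k :: nat
    by (simp add: bit_iff_odd mod_2_eq_odd)
  ultimately show "total_rec 2 (\<lambda>ys. of_bool (bit (ys ! 0) (ys ! 1)))"
    by simp
qed

text \<open>
  A number \<open>u\<close> stands for the binary string of length \<open>u\<close> formed by its lowest \<open>u\<close> bits. As
  \<open>u < 2 ^ u\<close>, the strings \<open>extend u k\<close> prolong \<open>u\<close>; only prolongations of this special form occur.
\<close>

definition extend :: "nat \<Rightarrow> nat \<Rightarrow> nat" where
  "extend u k = u + 2 ^ u * k"

lemma total_rec_extend:
  assumes "total_rec m F" "total_rec m G"
  shows "total_rec m (\<lambda>xs. extend (F xs) (G xs))"
proof (rule total_rec_comp2[OF _ assms])
  have "total_rec 2 (\<lambda>xs. xs ! 0 +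
      rec_nat (xs ! 1) (\<lambda>n r. (n # r # xs) ! 1 + (n # r # xs) ! 1) (xs ! 0))"
    by (intro total_rec_rec_nat total_rec_add total_rec_nth) simp_all
  moreover have "rec_nat k (\<lambda>n r. r + r) a = 2 ^ a * k" for a k :: nat
    by (induction a) simp_all
  ultimately show "total_rec 2 (\<lambda>ys. extend (ys ! 0) (ys ! 1))"
    by (simp add: extend_def)
qed

section \<open>Evaluation with a finite oracle\<close>

text \<open>
  The value 0 means that no output was found, and \<open>Suc y\<close> stands for the output \<open>y\<close>. The string
  \<open>u\<close> serves both as the oracle and as the bound for unbounded searches. In the recursion for
  \<open>Mu\<close>, the state 0 means that the search goes on, 1 that it got stuck at an undefined value, and
  \<open>Suc (Suc n)\<close> that it succeeded at \<open>n\<close>.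
\<close>

fun approx :: "nat \<Rightarrow> ocode \<Rightarrow> nat list \<Rightarrow> nat" where
  "approx u Zero xs = 1"
| "approx u Succ xs = (if length xs = 1 then Suc (Suc (xs ! 0)) else 0)"
| "approx u (Proj i) xs = (if i < length xs then Suc (xs ! i) else 0)"
| "approx u Oracle xs =
    (if length xs = 1 \<and> xs ! 0 < u then Suc (of_bool (bit u (xs ! 0))) else 0)"
| "approx u (Comp c ds) xs =
    (if \<exists>d \<in> set ds. approx u d xs = 0 then 0 else approx u c (map (\<lambda>d. approx u d xs - 1) ds))"
| "approx u (PrimRec c d) xs =
    (if xs = [] then 0
     else rec_nat (approx u c (tl xs))
       (\<lambda>n r. if r = 0 then 0 else approx u d (n # (r - 1) # tl xs)) (hd xs))"
| "approx u (Mu c) xs =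
    rec_nat 0 (\<lambda>n r. if r = 0 then
        (if approx u c (n # xs) = 0 then 1
         else if approx u c (n # xs) - 1 = 0 then Suc (Suc n) else 0)
      else r) u - 1"


section \<open>Recursiveness of the evaluation with a finite oracle\<close>

lemma total_rec_append_drop:
  assumes F: "total_rec (length Gs + k) F" and Gs: "\<And>G. G \<in> set Gs \<Longrightarrow> total_rec m G"
    and m: "m = j + k"
  shows "total_rec m (\<lambda>xs. F (map (\<lambda>G. G xs) Gs @ drop j xs))"
proof -
  \<comment> \<open>Projections reproduce \<open>drop j xs\<close>, so a subcode can be run on a new
    front segment followed by the old parameters.\<close>
  have "total_rec m (\<lambda>xs. F (map (\<lambda>G. G xs) (Gs @ map (\<lambda>i xs. xs ! i) [j..<m])))"
    using F Gs m by (intro total_rec_comp) (auto intro: total_rec_nth)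
  moreover have "map (\<lambda>i. xs ! i) [j..<m] = drop j xs" if "length xs = m" for xs :: "nat list"
    using that by (intro nth_equalityI) auto
  ultimately show ?thesis by (elim total_rec_cong) (simp add: comp_def)
qed

lemma total_rec_Bex_zero:
  assumes "\<And>G. G \<in> set Gs \<Longrightarrow> total_rec m G"
  shows "total_rec m (\<lambda>xs. if \<exists>G \<in> set Gs. G xs = 0 then 0 else 1)"
  using assms
proof (induction Gs)
  case Nil
  then show ?case using total_rec_const[of m 1] by simp
next
  case (Cons G Gs)
  then have "total_rec m (\<lambda>xs. if G xs = 0 then 0
      else if \<exists>G \<in> set Gs. G xs = 0 then 0 else 1)"
    by (intro total_rec_if_zero total_rec_const) auto
  then show ?case by (rule total_rec_cong) auto
qed

text \<open>The code \<open>c\<close> is fixed while the string varies, so induction on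
  \<open>c\<close> suffices and no numbering of codes enters. \<open>m\<close> is arbitrary because
  subcodes run at other arities.\<close>

lemma total_rec_approx: "total_rec (Suc m) (\<lambda>ys. approx (ys ! 0) c (tl ys))"
proof (induction c arbitrary: m)
  case Zero
  show ?case using total_rec_const[of "Suc m" 1] by simp
next
  case Succ
  show ?case
  proof (cases "m = 1")
    case True
    have "total_rec (Suc m) (\<lambda>ys. Suc (Suc (ys ! 1)))"
      using True by (intro total_rec_Suc total_rec_nth) simp
    then show ?thesis by (rule total_rec_cong) (simp add: True nth_tl)
  next
    case False
    then show ?thesis by (intro total_rec_cong[OF total_rec_const[of _ 0]]) simp
  qed
next
  case (Proj i)
  show ?case
  proof (cases "i < m")
    case True
    have "total_rec (Suc m) (\<lambda>ys. Suc (ys ! Suc i))"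
      using True by (intro total_rec_Suc total_rec_nth) simp
    then show ?thesis by (rule total_rec_cong) (simp add: True nth_tl)
  next
    case False
    then show ?thesis by (intro total_rec_cong[OF total_rec_const[of _ 0]]) simp
  qed
next
  case Oracle
  show ?case
  proof (cases "m = 1")
    case True
    have "total_rec (Suc m) (\<lambda>ys. if ys ! 0 - ys ! 1 = 0 then 0
        else Suc (of_bool (bit (ys ! 0) (ys ! 1))))"
      using True
      by (intro total_rec_if_zero total_rec_const total_rec_Suc total_rec_bit total_rec_diff
          total_rec_nth) simp_all
    then show ?thesis by (rule total_rec_cong) (simp add: True nth_tl)
  next
    case False
    then show ?thesis by (intro total_rec_cong[OF total_rec_const[of _ 0]]) simp
  qed
next
  case (Comp c ds)
  let ?D = "map (\<lambda>d ys. approx (ys ! 0) d (tl ys)) ds"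
  let ?E = "(\<lambda>ys. ys ! 0) # map (\<lambda>d ys. approx (ys ! 0) d (tl ys) - 1) ds"
  have D: "total_rec (Suc m) (\<lambda>xs. if \<exists>G \<in> set ?D. G xs = 0 then 0 else 1)"
    using Comp by (intro total_rec_Bex_zero) auto
  have E: "total_rec (Suc m) (\<lambda>ys. (\<lambda>zs. approx (zs ! 0) c (tl zs)) (map (\<lambda>G. G ys) ?E))"
    using Comp by (intro total_rec_comp)
      (auto simp del: One_nat_def intro: total_rec_nth total_rec_pred)
  show ?case
    by (rule total_rec_cong[OF total_rec_if_zero[OF D total_rec_const[of _ 0] E]])
      (auto simp: comp_def)
next
  case (PrimRec c d)
  show ?case
  proof (cases m)
    case 0
    then show ?thesis
      by (intro total_rec_cong[OF total_rec_const[of _ 0]]) (auto simp: length_Suc_conv)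
  next
    case (Suc k)
    let ?a = "\<lambda>e zs. approx (zs ! 0) e (tl zs)"
    have "total_rec (Suc m) (\<lambda>ys. ?a c (map (\<lambda>G. G ys) [\<lambda>ys. ys ! 0] @ drop 2 ys))"
      using PrimRec(1)[of k] Suc
      by (intro total_rec_append_drop[where k = k]) (auto intro: total_rec_nth)
    moreover have "total_rec (Suc (Suc (Suc m))) (\<lambda>zs. zs ! 1 - 1)"
      by (intro total_rec_pred total_rec_nth) simp
    \<comment> \<open>\<open>zs\<close> lists the counter, the previous value, \<open>u\<close>, the
      recursion argument and the parameters; \<open>- 1\<close> decodes the previous value.\<close>
    then have "total_rec (Suc (Suc (Suc m))) (\<lambda>zs. ?a d (map (\<lambda>G. G zs)
        [\<lambda>zs. zs ! 2, \<lambda>zs. zs ! 0, \<lambda>zs. zs ! 1 - 1] @ drop 4 zs))"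
      using PrimRec(2)[of "Suc (Suc k)"] Suc
      by (intro total_rec_append_drop[where k = k]) 
        (auto intro: total_rec_nth)
    then have "total_rec (Suc (Suc (Suc m))) (\<lambda>zs. if zs ! 1 = 0 then 0 else ?a d (map (\<lambda>G. G zs)
        [\<lambda>zs. zs ! 2, \<lambda>zs. zs ! 0, \<lambda>zs. zs ! 1 - 1] @ drop 4 zs))"
      by (intro total_rec_if_zero total_rec_const total_rec_nth) auto
    moreover have "total_rec (Suc m) (\<lambda>ys. ys ! 1)" using Suc by (intro total_rec_nth) simp
    ultimately have "total_rec (Suc m) (\<lambda>ys. rec_nat
        (?a c (map (\<lambda>G. G ys) [\<lambda>ys. ys ! 0] @ drop 2 ys))
        (\<lambda>n r. (\<lambda>zs. if zs ! 1 = 0 then 0 else ?a d (map (\<lambda>G. G zs)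
          [\<lambda>zs. zs ! 2, \<lambda>zs. zs ! 0, \<lambda>zs. zs ! 1 - 1] @ drop 4 zs)) (n # r # ys)) (ys ! 1))"
      by (rule total_rec_rec_nat)
    then show ?thesis
      by (rule total_rec_cong) (auto simp: Suc length_Suc_conv numeral_eq_Suc cong: if_cong)
  qed
next
  case (Mu c)
  let ?A = "\<lambda>zs. (\<lambda>zs. approx (zs ! 0) c (tl zs)) (map (\<lambda>G. G zs)
      [\<lambda>zs. zs ! 2, \<lambda>zs. zs ! 0] @ drop 3 zs)"
  let ?S = "\<lambda>zs. if zs ! 1 = 0
      then (if ?A zs = 0 then 1 else if ?A zs - 1 = 0 then Suc (Suc (zs ! 0)) else 0) else zs ! 1"
  have A: "total_rec (Suc (Suc (Suc m))) ?A"
    using Mu[of "Suc m"] by (intro total_rec_append_drop[where k = m]) (auto intro: total_rec_nth)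
  have "total_rec (Suc (Suc (Suc m))) ?S"
    by (intro total_rec_if_zero total_rec_const total_rec_nth A total_rec_pred[OF A] total_rec_Suc)
      auto
  then have "total_rec (Suc m) (\<lambda>ys. rec_nat 0 (\<lambda>n r. ?S (n # r # ys)) (ys ! 0) - 1)"
    by (intro total_rec_pred total_rec_rec_nat total_rec_const total_rec_nth) auto
  then show ?case
  proof (rule total_rec_cong)
    fix ys :: "nat list" assume "length ys = Suc m"
    then obtain u xs where ys: "ys = u # xs" by (cases ys) auto
    have "?A (n # r # ys) = approx u c (n # xs)" for n r
      by (simp add: ys numeral_2_eq_2 numeral_3_eq_3)
    then show "approx (ys ! 0) (Mu c) (tl ys)
        = rec_nat 0 (\<lambda>n r. ?S (n # r # ys)) (ys ! 0) - 1"
      by (simp only: ys approx.simps nth_Cons_0 list.sel One_nat_def nth_Cons_Suc)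
  qed
qed

section \<open>Soundness and completeness of the evaluation with a finite oracle\<close>

definition agrees :: "(nat \<Rightarrow> bool) \<Rightarrow> nat \<Rightarrow> bool" where
  "agrees g u \<longleftrightarrow> (\<forall>n < u. g n = bit u n)"

definition chi :: "(nat \<Rightarrow> bool) \<Rightarrow> nat \<Rightarrow> nat" where
  "chi g n = of_bool (g n)"

text \<open>Invariant of the search, one disjunct per state. In the shifted coding of outputs,
  \<open>v m > 1\<close> is a positive value, \<open>v m = 1\<close> the value zero and
  \<open>v m = 0\<close> no value.\<close>

lemma bounded_search_cases:
  fixes v :: "nat \<Rightarrow> nat"
  defines "r \<equiv> rec_nat 0 (\<lambda>n r. if r = 0 then
        (if v n = 0 then 1 else if v n - 1 = 0 then Suc (Suc n) else 0) else r)"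
  shows "r u = 0 \<and> (\<forall>m < u. v m > 1)
    \<or> r u = 1 \<and> (\<exists>n < u. v n = 0 \<and> (\<forall>m < n. v m > 1))
    \<or> (\<exists>n < u. r u = Suc (Suc n) \<and> v n = 1 \<and> (\<forall>m < n. v m > 1))"
proof (induction u)
  case 0
  show ?case by (simp add: r_def)
next
  case (Suc u)
  have rSuc: "r (Suc u) = (if r u = 0 then
        (if v u = 0 then 1 else if v u - 1 = 0 then Suc (Suc u) else 0) else r u)"
    by (simp add: r_def)
  from Suc show ?case
  proof (elim disjE)
    assume *: "r u = 0 \<and> (\<forall>m < u. v m > 1)"
    consider "v u = 0" | "v u = 1" | "v u > 1" by linarith
    then show ?thesis using * by cases (auto simp: rSuc less_Suc_eq)
  qed (auto simp: rSuc less_Suc_eq)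
qed

text \<open>Only one \<open>n\<close> can be the first with \<open>v n \<le> 1\<close>, and the
  outer \<open>- 1\<close> turns both the searching and the stuck state into \<open>0\<close>, that
  is, no output.\<close>

lemma bounded_search_iff:
  fixes v :: "nat \<Rightarrow> nat"
  shows "rec_nat 0 (\<lambda>n r. if r = 0 then
        (if v n = 0 then 1 else if v n - 1 = 0 then Suc (Suc n) else 0) else r) u - 1 = Suc n
    \<longleftrightarrow> n < u \<and> v n = 1 \<and> (\<forall>m < n. v m > 1)" (is "?r - 1 = _ \<longleftrightarrow> ?Q n")
  using bounded_search_cases[of v u]
proof (elim disjE exE conjE)
  fix i assume i: "i < u" "?r = Suc (Suc i)" "v i = 1" "\<forall>m < i. v m > 1"
  have "i = n" if "?Q n"
    using i that by (metis less_irrefl linorder_neqE_nat)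
  with i show ?thesis by auto
next
  fix i assume i: "i < u" "?r = 1" "v i = 0" "\<forall>m < i. v m > 1"
  have False if "?Q n"
    using i that by (metis less_irrefl linorder_neqE_nat not_less_zero zero_neq_one)
  with i show ?thesis by auto
qed auto

lemma approx_PrimRec_Suc:
  "approx u (PrimRec c d) (Suc n # xs) = (if approx u (PrimRec c d) (n # xs) = 0 then 0
    else approx u d (n # (approx u (PrimRec c d) (n # xs) - 1) # xs))"
  by (simp cong: if_cong)

text \<open>A successful finite computation queries only positions below \<open>u\<close>, where
  \<open>g\<close> and the string coincide.\<close>

lemma approx_sound:
  assumes g: "agrees g u"
  shows "approx u c xs = Suc y \<Longrightarrow> eval (chi g) c xs y"
proof (induction c arbitrary: xs y)
  case Zero
  then show ?case by (auto intro: eval_Zero)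
next
  case Succ
  then show ?case by (auto simp: length_Suc_conv split: if_splits intro: eval_Succ)
next
  case (Proj i)
  then show ?case by (auto split: if_splits intro: eval_Proj)
next
  case Oracle
  then obtain x where "xs = [x]" "x < u" "y = of_bool (bit u x)"
    by (auto simp: length_Suc_conv split: if_splits)
  moreover from this g have "y = chi g x" by (simp add: agrees_def chi_def)
  ultimately show ?case using eval_Oracle[of "chi g" x] by simp
next
  case (Comp c ds)
  then have ds: "\<forall>d \<in> set ds. approx u d xs \<noteq> 0"
    and c: "approx u c (map (\<lambda>d. approx u d xs - 1) ds) = Suc y"
    by (auto split: if_splits)
  have "list_all2 (\<lambda>d y. eval (chi g) d xs y) ds (map (\<lambda>d. approx u d xs - 1) ds)"
    using ds Comp.IH(2) by (auto simp: list_all2_conv_all_nth)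
  then show ?case using Comp.IH(1)[OF c] by (rule eval_Comp)
next
  case (PrimRec c d)
  then obtain n zs where xs: "xs = n # zs" by (cases xs) auto
  show ?case using PrimRec.prems unfolding xs
  proof (induction n arbitrary: y)
    case 0
    then show ?case using PrimRec.IH(1) by (auto intro: eval_PrimRec_0)
  next
    case (Suc n)
    let ?p = "approx u (PrimRec c d) (n # zs)"
    have eq: "(if ?p = 0 then 0 else approx u d (n # (?p - 1) # zs)) = Suc y"
      using Suc.prems unfolding approx_PrimRec_Suc .
    then have "?p \<noteq> 0" by (metis nat.distinct(1))
    then obtain r where r: "?p = Suc r" by (metis not0_implies_Suc)
    with eq have "approx u d (n # r # zs) = Suc y"
      by (simp only: r nat.distinct if_False diff_Suc_1)
    note PrimRec.IH(2)[OF this]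
    with Suc.IH[OF r] show ?case by (rule eval_PrimRec_Suc)
  qed
next
  case (Mu c)
  from Mu.prems have y: "approx u c (y # xs) = 1" "\<And>m. m < y \<Longrightarrow> approx u c (m # xs) > 1"
    by (simp_all only: approx.simps bounded_search_iff)
  show ?case
  proof (rule eval_Mu)
    show "eval (chi g) c (y # xs) 0" using y(1) by (intro Mu.IH) simp
    show "\<exists>k. eval (chi g) c (m # xs) (Suc k)" if m: "m < y" for m
    proof -
      obtain k where "approx u c (m # xs) = Suc (Suc k)"
        using less_imp_Suc_add[OF y(2)[OF m]] by auto
      then have "eval (chi g) c (m # xs) (Suc k)" by (rule Mu.IH)
      then show ?thesis ..
    qed
  qed
qed

text \<open>As a filter, so that the finitely many subcomputations of a computation combine without
  explicit bounds on queries and searches.\<close>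

definition approximants :: "(nat \<Rightarrow> bool) \<Rightarrow> nat filter" where
  "approximants g = (INF L. principal {u. L \<le> u \<and> (\<forall>n < L. bit u n = g n)})"

lemma eventually_approximants:
  "eventually P (approximants g) \<longleftrightarrow> (\<exists>L. \<forall>u \<ge> L. (\<forall>n < L. bit u n = g n) \<longrightarrow> P u)"
proof -
  have "eventually P (approximants g) \<longleftrightarrow>
      (\<exists>L \<in> UNIV. eventually P (principal {u. L \<le> u \<and> (\<forall>n < L. bit u n = g n)}))"
    unfolding approximants_def
  proof (rule eventually_INF_base)
    fix K L :: nat
    show "\<exists>M \<in> UNIV. principal {u. M \<le> u \<and> (\<forall>n < M. bit u n = g n)} \<le>
        inf (principal {u. K \<le> u \<and> (\<forall>n < K. bit u n = g n)})
          (principal {u. L \<le> u \<and> (\<forall>n < L. bit u n = g n)})"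
      by (rule bexI[of _ "max K L"]) auto
  qed simp
  then show ?thesis by (auto simp: eventually_principal)
qed

text \<open>A halting computation makes finitely many queries and finite searches, so every string
  that is long enough and shares enough bits with \<open>g\<close> reproduces it.\<close>

lemma approx_complete:
  "eval (chi g) c xs y \<Longrightarrow> \<forall>\<^sub>F u in approximants g. approx u c xs = Suc y"
proof (induction rule: eval.induct)
  case (eval_Oracle x)
  show ?case unfolding eventually_approximants
    by (rule exI[of _ "Suc x"]) (auto simp: chi_def)
next
  case (eval_Comp xs ds ys c z)
  have len: "length ds = length ys"
    using eval_Comp.IH(1) by (rule list_all2_lengthD)
  have "\<forall>\<^sub>F u in approximants g. \<forall>i \<in> {..<length ds}. approx u (ds ! i) xs = Suc (ys ! i)"
    by (rule eventually_ball_finite) (use eval_Comp.IH(1) in \<open>auto simp: list_all2_conv_all_nth\<close>)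
  with eval_Comp.IH(2) show ?case
  proof eventually_elim
    case (elim u)
    have "map (\<lambda>d. approx u d xs - 1) ds = ys"
      using elim(2) len by (intro nth_equalityI) auto
    moreover have "\<forall>d \<in> set ds. approx u d xs \<noteq> 0"
      using elim(2) by (auto simp: in_set_conv_nth)
    ultimately show ?case using elim(1) by auto
  qed
next
  case (eval_PrimRec_0 c xs y d)
  then show ?case by simp
next
  case (eval_PrimRec_Suc c d n xs r y)
  from eval_PrimRec_Suc.IH show ?case
    by eventually_elim (simp only: approx_PrimRec_Suc, simp)
next
  case (eval_Mu c n xs)
  have "\<forall>\<^sub>F u in approximants g. \<forall>m \<in> {..<n}. approx u c (m # xs) > 1"
  proof (rule eventually_ball_finite, simp, intro ballI)
    fix m assume "m \<in> {..<n}"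
    then obtain k where "\<forall>\<^sub>F u in approximants g. approx u c (m # xs) = Suc (Suc k)"
      using eval_Mu.IH(2) by auto
    then show "\<forall>\<^sub>F u in approximants g. approx u c (m # xs) > 1"
      by eventually_elim simp
  qed
  moreover have "\<forall>\<^sub>F u in approximants g. n < u"
    unfolding eventually_approximants by (rule exI[of _ "Suc n"]) auto
  ultimately show ?case using eval_Mu.IH(1)
  proof eventually_elim
    case (elim u)
    then show ?case unfolding approx.simps bounded_search_iff by simp
  qed
qed simp_all


section \<open>Generic oracles\<close>

text \<open>Justifies reading \<open>extend u k\<close> as a prolongation of the string
  \<open>u\<close> by the bits of \<open>k\<close>.\<close>

lemma bit_extend: "bit (extend u k) n = (if n < u then bit u n else bit k (n - u))"
proof (cases "n < u")
  case True
  then obtain j where j: "u = n + Suc j" using less_imp_Suc_add by auto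
  \<comment> \<open>The added summand is an even multiple of \<open>2 ^ n\<close>, so it leaves bit
    \<open>n\<close> unchanged.\<close>
  have "extend u k = u + 2 ^ n * (2 * (2 ^ j * k))"
    unfolding extend_def by (subst (2) j) (simp add: power_add)
  then have "extend u k div 2 ^ n = u div 2 ^ n + 2 * (2 ^ j * k)"
    by simp
  then show ?thesis using True by (simp add: bit_iff_odd)
next
  case False
  then obtain j where j: "n = u + j" using le_Suc_ex by (auto simp: not_less)
  \<comment> \<open>Dividing by \<open>2 ^ u\<close> first removes \<open>u\<close>, because
    \<open>u < 2 ^ u\<close>.\<close>
  have "extend u k div 2 ^ n = k div 2 ^ j"
    by (simp add: j extend_def power_add div_mult2_eq)
  then show ?thesis using False by (simp add: j bit_iff_odd)
qed

lemma extend_ge: "u \<le> extend u k"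
  by (simp add: extend_def)

lemma extend_gt: "k > 0 \<Longrightarrow> u < extend u k"
  by (simp add: extend_def)

lemma agrees_extendD: "agrees g (extend u k) \<Longrightarrow> agrees g u"
  using extend_ge[of u k] unfolding agrees_def by (metis bit_extend less_le_trans)

text \<open>
  The new second argument is \<open>s + 2 ^ (extend u s - u) * k\<close>, phrased through \<open>extend\<close> so that its
  recursiveness needs no separate treatment of powers.
\<close>

lemma extend_extend:
  "extend (extend u s) k = extend u (s + (extend (extend u s - u) k - (extend u s - u)))"
proof -
  have "2 ^ extend u s = 2 ^ u * (2 ^ (extend u s - u) :: nat)"
    using extend_ge[of u s] by (simp flip: power_add)
  then have "2 ^ extend u s * k = 2 ^ u * (2 ^ (extend u s - u) * k)" by simp
  then show ?thesis
    unfolding extend_def[of "extend u s"] extend_def[of "extend u s - u"]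
    unfolding extend_def[of u] by (simp add: distrib_left)
qed

text \<open>Turns eventual truth into truth at a single prolongation, obtained by following
  \<open>g\<close> far enough beyond \<open>u\<close>.\<close>

lemma ex_extend_approximants:
  assumes g: "agrees g u" and P: "\<forall>\<^sub>F u in approximants g. P u"
  shows "\<exists>k. P (extend u k)"
proof -
  obtain L where L: "\<And>v. L \<le> v \<Longrightarrow> \<forall>n < L. bit v n = g n \<Longrightarrow> P v"
    using P unfolding eventually_approximants by blast
  define M where "M = max L u"
  \<comment> \<open>The final \<open>True\<close> is a marker at position \<open>M\<close>: it makes
    the number, which is also the length of the string, at least \<open>2 ^ M\<close>.\<close>
  define k :: nat where "k = horner_sum of_bool 2 (map g [u..<M] @ [True])"
  have k: "bit k n = (if n < M - u then g (u + n) else n = M - u)" for n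
    by (auto simp: k_def bit_horner_sum_bit_iff nth_append)
  have "bit (extend u k) n = g n" if "n < M" for n
    using g that by (auto simp: bit_extend k agrees_def)
  moreover have "M \<le> extend u k"
  proof (rule ccontr)
    assume "\<not> M \<le> extend u k"
    moreover have "M < 2 ^ M" by simp
    ultimately have "extend u k div 2 ^ M = 0" by (intro div_less) linarith
    moreover have "bit (extend u k) M" by (simp add: bit_extend k M_def)
    ultimately show False by (simp add: bit_iff_odd)
  qed
  ultimately have "P (extend u k)" by (intro L) (auto simp: M_def)
  then show ?thesis ..
qed

text \<open>Finite extension construction: stage \<open>i\<close> meets requirement
  \<open>i\<close>, and \<open>g\<close> is the union of the resulting chain of strings.\<close>

lemma ex_generic:
  fixes P :: "nat \<Rightarrow> nat \<Rightarrow> bool"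
  assumes "\<And>i u. \<exists>k. P i (extend u k)"
  shows "\<exists>g. \<forall>i. \<exists>u. P i u \<and> agrees g u"
proof -
  obtain K where K: "\<And>i u. P i (extend u (K i u))" using assms by metis
  \<comment> \<open>The extension by 1 forces growth even when \<open>K\<close> returns 0, as
    \<open>extend u 0 = u\<close>.\<close>
  define v where "v = rec_nat 0 (\<lambda>i u. extend (extend u 1) (K i (extend u 1)))"
  have v_Suc: "v (Suc i) = extend (extend (v i) 1) (K i (extend (v i) 1))" for i
    by (simp add: v_def)
  have v_less: "v i < v (Suc i)" for i
    unfolding v_Suc by (rule less_le_trans[OF extend_gt extend_ge]) simp
  have mono: "strict_mono v" using v_less by (simp add: strict_mono_Suc_iff)
  have le: "i \<le> v i" for i using mono by (rule strict_mono_imp_increasing)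
  have bit_Suc: "bit (v (Suc i)) n = bit (v i) n" if "n < v i" for i n
    using that less_trans[OF that extend_gt[of 1 "v i"]] by (simp add: v_Suc bit_extend)
  have bit: "bit (v j) n = bit (v i) n" if "i \<le> j" "n < v i" for i j n
    using that
  proof (induction j rule: dec_induct)
    case (step m)
    then have "n < v m" using strict_mono_less_eq[OF mono, of i m] by simp
    with step show ?case using bit_Suc by simp
  qed simp
  \<comment> \<open>Bit \<open>n\<close> is settled by stage \<open>Suc n\<close>, because
    \<open>n < v (Suc n)\<close>.\<close>
  have "agrees (\<lambda>n. bit (v (Suc n)) n) (v i)" for i
    unfolding agrees_def
  proof (intro allI impI)
    fix n assume "n < v i"
    then show "bit (v (Suc n)) n = bit (v i) n"
      using bit[of i "Suc n" n] bit[of "Suc n" i n] le[of "Suc n"] by (cases "i \<le> Suc n") auto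
  qed
  then show ?thesis using K v_Suc by metis
qed

section \<open>Avoiding a closed set without computable elements\<close>

lemma closed_baire_memI:
  fixes A :: "(nat \<Rightarrow> nat) set"
  assumes "closed A" and f: "\<And>N. \<exists>h \<in> A. \<forall>n < N. h n = f n"
  shows "f \<in> A"
proof -
  obtain h where h: "\<And>N. h N \<in> A" "\<And>N n. n < N \<Longrightarrow> h N n = f n" using f by metis
  have "h \<longlonglongrightarrow> f"
  proof -
    have "(\<lambda>N. h N n) \<longlonglongrightarrow> f n" for n
    proof (rule tendsto_eventually)
      show "\<forall>\<^sub>F N in sequentially. h N n = f n"
        using eventually_gt_at_top[of n] by eventually_elim (rule h)
    qed
    then have "limitin (product_topology (\<lambda>_. euclidean) UNIV) h f sequentially"
      by (simp add: limitin_componentwise)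
    then show ?thesis by (simp add: euclidean_product_topology)
  qed
  then show ?thesis
    using h(1) assms(1) by (intro Lim_in_closed_set[of A h sequentially]) auto
qed

lemma ex_extend_avoiding_closed:
  assumes "closed A" and A: "\<And>f. f \<in> A \<Longrightarrow> \<not> computable f"
  shows "\<exists>k. \<forall>g. agrees g (extend u k) \<longrightarrow> \<not> (\<exists>f \<in> A. \<forall>n. eval (chi g) c [n] (f n))"
proof (rule ccontr)
  assume "\<not> ?thesis"
  then have ex_g: "\<exists>g f. agrees g (extend u k) \<and> f \<in> A \<and> (\<forall>n. eval (chi g) c [n] (f n))" for k
    by blast
  \<comment> \<open>An oracle above the string \<open>extend u s\<close> that is mapped into
    \<open>A\<close> makes \<open>c\<close> halt on \<open>n\<close>; a finite part of it already
    does.\<close>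
  have ex_k: "\<exists>k. approx (extend (extend u s) k) c [n] \<noteq> 0" for s n
  proof -
    obtain g f where g: "agrees g (extend u s)" "\<forall>n. eval (chi g) c [n] (f n)"
      using ex_g[of s] by blast
    then have "\<forall>\<^sub>F v in approximants g. approx v c [n] = Suc (f n)"
      by (intro approx_complete) simp
    from ex_extend_approximants[OF g(1) this] show ?thesis by (metis nat.distinct(1))
  qed
  \<comment> \<open>Search test, zero on success. The arguments are the candidate prolongation, the
    input \<open>n\<close> and the current parameter \<open>s\<close>.\<close>
  define F where "F ys = (if approx (extend (extend u (ys ! 2)) (ys ! 0)) c [ys ! 1] = 0
    then 1 else 0 :: nat)" for ys
  define K where "K ys = (LEAST k. F (k # ys) = 0)" for ys
  \<comment> \<open>By \<open>extend_extend\<close>, this is the parameter over the fixed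
    \<open>u\<close> of the string prolonged by the search result.\<close>
  define step where "step ys = ys ! 1 + (extend (extend u (ys ! 1) - u) (K ys)
    - (extend u (ys ! 1) - u))" for ys
  define s where "s n = rec_nat 0 (\<lambda>n r. step [n, r]) n" for n
  \<comment> \<open>The string of stage \<open>Suc n\<close> makes \<open>c\<close> halt on
    \<open>n\<close>; \<open>- 1\<close> decodes the output.\<close>
  define f where "f n = approx (extend u (s (Suc n))) c [n] - 1" for n
  have rec_u: "total_rec m (\<lambda>xs. extend u (G xs))" if "total_rec m G" for m G
    using total_rec_extend[OF total_rec_const that] .
  have rec_approx: "total_rec m (\<lambda>xs. approx (G xs) c [H xs])"
    if "total_rec m G" "total_rec m H" for m G H
  proof (rule total_rec_comp2[OF _ that])
    have "total_rec 2 (\<lambda>ys. approx (ys ! 0) c (tl ys))"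
      using total_rec_approx[of 1 c] by (simp add: numeral_2_eq_2)
    then show "total_rec 2 (\<lambda>ys. approx (ys ! 0) c [ys ! 1])"
      by (rule total_rec_cong) (auto simp: length_Suc_conv numeral_2_eq_2)
  qed
  have F: "total_rec 3 F"
    unfolding F_def
    by (intro total_rec_if_zero rec_approx total_rec_extend rec_u total_rec_nth total_rec_const)
      simp_all
  have F_ex: "\<exists>k. F (k # ys) = 0" for ys
    using ex_k[of "ys ! 1" "ys ! 0"] by (simp add: F_def)
  have K: "total_rec 2 K"
    unfolding K_def using F F_ex by (intro total_rec_LEAST) (simp_all add: eval_nat_numeral)
  have step: "total_rec 2 step"
    unfolding step_def
    by (intro total_rec_add total_rec_diff total_rec_extend rec_u K total_rec_nth total_rec_const)
      simp_all
  have "total_rec 3 (\<lambda>xs. step (map (\<lambda>G. G xs) [\<lambda>xs. xs ! 0, \<lambda>xs. xs ! 1]))"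
    using step by (intro total_rec_comp) (auto simp: total_rec_nth numeral_2_eq_2)
  then have "total_rec 3 (\<lambda>xs. step [xs ! 0, xs ! 1])"
    by simp
  then have "total_rec 1 (\<lambda>xs. rec_nat 0 (\<lambda>n r. (\<lambda>xs. step [xs ! 0, xs ! 1]) (n # r # xs))
      (Suc (xs ! 0)))"
    by (intro total_rec_rec_nat total_rec_const total_rec_Suc total_rec_nth)
      (simp_all add: eval_nat_numeral)
  then have "total_rec 1 (\<lambda>xs. s (Suc (xs ! 0)))"
    by (simp add: s_def)
  then have "total_rec 1 (\<lambda>xs. f (xs ! 0))"
    unfolding f_def by (intro total_rec_pred rec_approx rec_u total_rec_nth) simp_all
  then have "computable f"
    unfolding total_rec_def computable_def by (metis One_nat_def length_Cons list.size(3) nth_Cons_0)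
  have s_Suc: "extend u (s (Suc n)) = extend (extend u (s n)) (K [n, s n])" for n
    unfolding extend_extend by (simp add: s_def step_def)
  have f_eq: "approx (extend u (s (Suc n))) c [n] = Suc (f n)" for n
  proof -
    have "F (K [n, s n] # [n, s n]) = 0" unfolding K_def by (rule LeastI_ex[OF F_ex])
    then show ?thesis by (simp add: F_def f_def s_Suc split: if_splits)
  qed
  have "f \<in> A"
  proof (rule closed_baire_memI[OF \<open>closed A\<close>])
    fix N
    \<comment> \<open>A single \<open>g\<close> above the string of stage \<open>N\<close> serves
      all \<open>n < N\<close>, since the earlier strings are its initial segments; so
      \<open>f\<close> and \<open>h\<close> agree there.\<close>
    obtain g h where g: "agrees g (extend u (s N))" "h \<in> A" "\<forall>n. eval (chi g) c [n] (h n)"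
      using ex_g by blast
    have agr: "agrees g (extend u (s n))" if "n \<le> N" for n
      using that g(1) by (induction n rule: inc_induct) (auto simp: s_Suc dest: agrees_extendD)
    have "h n = f n" if "n < N" for n
      using approx_sound[OF agr f_eq] g(3) that eval_deterministic by (metis Suc_leI)
    then show "\<exists>h \<in> A. \<forall>n < N. h n = f n" using g(2) by blast
  qed
  with A \<open>computable f\<close> show False by blast
qed

instance ocode :: countable
  by countable_datatype

lemma ex_noncomputable_not_above_closed:
  assumes "closed A" and A: "\<And>f. f \<in> A \<Longrightarrow> \<not> computable f"
  shows "\<exists>h. \<not> computable h \<and> \<not> medvedev_le A {h}"
proof -
  \<comment> \<open>Requirement \<open>i\<close> concerns the code numbered \<open>i\<close>: it
    must neither map \<open>chi g\<close> into \<open>A\<close> nor compute \<open>chi g\<close>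
    with the zero oracle.\<close>
  define P where "P i u \<longleftrightarrow> (\<forall>g. agrees g u \<longrightarrow>
      \<not> (\<exists>f \<in> A. \<forall>n. eval (chi g) (from_nat i) [n] (f n)) \<and>
      \<not> (\<forall>n. eval (\<lambda>_. 0) (from_nat i) [n] (chi g n)))" for i u
  have "\<exists>k. P i (extend u k)" for i u
  proof -
    obtain k where k: "\<And>g. agrees g (extend u k) \<Longrightarrow>
        \<not> (\<exists>f \<in> A. \<forall>n. eval (chi g) (from_nat i) [n] (f n))"
      using ex_extend_avoiding_closed[OF assms, of u] by blast
    let ?v = "extend u k"
    \<comment> \<open>Diagonalisation at position \<open>?v\<close>: bit 0 of \<open>b\<close>
      becomes the bit there. The value 2 replaces 0 so that the string really reaches past
      \<open>?v\<close>.\<close>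
    define b :: nat where "b = (if eval (\<lambda>_. 0) (from_nat i) [?v] 1 then 2 else 1)"
    have "\<not> (\<forall>n. eval (\<lambda>_. 0) (from_nat i) [n] (chi g n))" if "agrees g (extend ?v b)" for g
    proof -
      have "b > 0" by (simp add: b_def)
      then have "g ?v = bit (extend ?v b) ?v"
        using that extend_gt by (simp add: agrees_def)
      then have "chi g ?v = (if eval (\<lambda>_. 0) (from_nat i) [?v] 1 then 0 else 1)"
        by (simp add: bit_extend b_def chi_def bit_0)
      then show ?thesis by (metis eval_deterministic zero_neq_one)
    qed
    then have "P i (extend ?v b)"
      unfolding P_def using k agrees_extendD by blast
    then show ?thesis unfolding extend_extend by blast
  qed
  from ex_generic[of P, OF this] obtain g where ex_u: "\<forall>i. \<exists>u. P i u \<and> agrees g u" by (elim exE)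
  have g: "\<not> (\<exists>f \<in> A. \<forall>n. eval (chi g) c [n] (f n))"
    "\<not> (\<forall>n. eval (\<lambda>_. 0) c [n] (chi g n))" for c
    using ex_u[rule_format, of "to_nat c"] unfolding P_def by auto
  have "\<not> computable (chi g)" using g(2) by (auto simp: computable_def)
  moreover have "\<not> medvedev_le A {chi g}" using g(1) by (auto simp: medvedev_le_iff_code)
  ultimately show ?thesis by blast
qed

section \<open>Complements of principal Turing ideals\<close>

text \<open>A code reducing the complement to \<open>{h}\<close> would compute from \<open>h\<close>
  a function outside the lower cone of \<open>h\<close>.\<close>

lemma not_medvedev_le_Compl_lower_cone:
  "\<not> medvedev_le {f. \<not> medvedev_le {f} {h}} {h}"
  unfolding medvedev_le_iff_code by auto

lemma join_irreducible_Compl_lower_cone: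
  "join_irreducible (medvedev_deg {f. \<not> medvedev_le {f} {h}})"
  unfolding join_irreducible_def
proof (intro notI, elim exE conjE)
  let ?J = "{f. \<not> medvedev_le {f} {h}}"
  fix b c assume less: "b < medvedev_deg ?J" "c < medvedev_deg ?J"
    and eq: "medvedev_deg ?J = sup b c"
  have "\<exists>X. y = medvedev_deg X" for y
    by (induction y rule: medvedev_degree.abs_induct) blast
  then obtain B C where bc: "b = medvedev_deg B" "c = medvedev_deg C"
    by metis
  \<comment> \<open>A problem missing the ideal is a subset of \<open>?J\<close>, hence lies above
    \<open>?J\<close>, against strictness.\<close>
  have meets: "\<exists>f \<in> X. medvedev_le {f} {h}" if "medvedev_deg X < medvedev_deg ?J" for X
  proof (rule ccontr)
    assume "\<not> ?thesis"
    then have "medvedev_le ?J X" by (intro medvedev_le_subset) auto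
    with that show False
      by (simp add: less_medvedev_degree_def less_eq_medvedev_degree.abs_eq)
  qed
  obtain f g where f: "f \<in> B" "medvedev_le {f} {h}" and g: "g \<in> C" "medvedev_le {g} {h}"
    using meets less bc by blast
  have "medvedev_le ?J (mass_join B C)"
    using eq unfolding bc by (metis less_eq_medvedev_degree.abs_eq order_refl
        sup_medvedev_degree.abs_eq)
  \<comment> \<open>Via the join of the two singletons, \<open>{h}\<close> would lie above
    \<open>?J\<close>.\<close>
  moreover have "medvedev_le (mass_join B C) (mass_join {f} {g})"
    using f g by (intro medvedev_le_subset) (auto simp: mass_join_def)
  moreover have "medvedev_le (mass_join {f} {g}) {h}"
    using f(2) g(2) by (rule medvedev_le_mass_join_least)
  ultimately show False
    using medvedev_le_trans not_medvedev_le_Compl_lower_cone by blast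
qed

text \<open>Degree zero is least, as the zero function is output uniformly by \<open>Zero\<close>.
  Hence every computable function lies in the lower cone of \<open>h\<close>.\<close>

lemma computable_medvedev_le:
  assumes "computable f" "f \<in> A"
  shows "medvedev_le A B"
proof -
  have "medvedev_le A {f. computable f}"
    using assms medvedev_deg_eq_zero_iff[of A] unfolding zero_degree_def
    by (metis less_eq_medvedev_degree.abs_eq order_refl)
  moreover have "medvedev_le {f. computable f} B"
  proof (rule medvedev_leI[where F = "\<lambda>_ _. 0"])
    show "(\<lambda>_. 0) \<in> {f. computable f}"
      using eval_Zero by (auto simp: computable_def intro!: exI[of _ Zero])
  qed (rule eval_Zero)
  ultimately show ?thesis by (rule medvedev_le_trans)
qed

theorem theorem7p2:
  fixes A :: "(nat \<Rightarrow> nat) set"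
  assumes "closed A"
    and "medvedev_deg A \<noteq> zero_degree"
  shows "\<exists>J :: medvedev_degree.
    join_irreducible J \<and> zero_prime_degree < J \<and> J \<le> medvedev_deg A"
proof -
  obtain h where h: "\<not> computable h" "\<not> medvedev_le A {h}"
    using ex_noncomputable_not_above_closed[OF assms(1)] assms(2)
    unfolding medvedev_deg_eq_zero_iff by blast
  let ?J = "{f. \<not> medvedev_le {f} {h}}"
  have "medvedev_le {f. \<not> computable f} ?J"
    by (rule medvedev_le_subset) (auto intro: computable_medvedev_le)
  \<comment> \<open>Restricted to the noncomputable \<open>h\<close>, such a reduction would put
    \<open>?J\<close> below \<open>{h}\<close>.\<close>
  moreover have "\<not> medvedev_le ?J {f. \<not> computable f}"
    using h(1) not_medvedev_le_Compl_lower_cone[of h] medvedev_le_trans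
      medvedev_le_subset[of "{h}" "{f. \<not> computable f}"] by blast
  \<comment> \<open>An element of \<open>A\<close> computable from \<open>h\<close> would put
    \<open>A\<close> below \<open>{h}\<close>, so \<open>A\<close> is a subset of
    \<open>?J\<close>.\<close>
  moreover have "medvedev_le ?J A"
  proof (rule medvedev_le_subset, rule subsetI, rule CollectI, rule notI)
    fix f assume "f \<in> A" "medvedev_le {f} {h}"
    then have "medvedev_le A {h}"
      using medvedev_le_trans medvedev_le_subset[of "{f}" A] by blast
    with h(2) show False ..
  qed
  ultimately show ?thesis
    using join_irreducible_Compl_lower_cone[of h]
    by (intro exI[of _ "medvedev_deg ?J"])
      (simp add: zero_prime_degree_def less_medvedev_degree_def less_eq_medvedev_degree.abs_eq)
qed

end
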